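(* Let $H$ be a Linear Hybrid Automaton, $l$ a location, and $U,V\subseteq\mathrm{Val}(X)$ polyhedra. For every polyhedron $W\subseteq\mathrm{Val}(X)$ let $$\tau(U,V,W)=U\cup\bigcup_{P\in[\![\overline V]\!]}\ \bigcup_{P'\in[\![W]\!]}\Big(P\cap \mathrm{Pre}^{\mathrm{flow}}_l\big(\mathrm{bound}(P,P')\cap\mathrm{Pre}^{\mathrm{flow}}_l(P')\big)\Big).$$ Then $\mathrm{RWA}^m_l(U,V)=\mu W.\,\tau(U,V,W)$, the least fixpoint of $W\mapsto\tau(U,V,W)$.
   Context: A convex polyhedron is a finite intersection of strict or non-strict affine half-spaces of $\mathbb{R}^n$; a polyhedron is a finite union of convex polyhedra. For a polyhedron $G$, $\mathrm{cl}(G)$ is its topological closure and $[\![G]\!]$ is its representation as a finite set of convex polyhedra whose union is $G$; $\overline G$ is the complement in $\mathrm{Val}(X)\cong\mathbb{R}^n$. $\mathrm{bound}(G,G')=(\mathrm{cl}(G)\cap G')\cup(G\cap\mathrm{cl}(G'))$. An LHA $H$ has, among other components, a finite set $\mathrm{Loc}$ of locations, real variables $X=\{x_1,\dots,x_n\}$, and for each location $l$ a convex polyhedron $\mathrm{Flow}(l)\subseteq\mathbb{R}^n$ of allowed derivatives. An activity $f:\mathbb{R}_{\ge0}\to\mathrm{Val}(X)$ (differentiable) is admissible from $\langle l,u\rangle$ if $f(0)=u$ and $\dot f(\delta)\in\mathrm{Flow}(l)$ for all $\delta\ge0$; $\mathrm{Adm}(\langle l,u\rangle)$ is the set of such activities.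 Pre-flow: $\mathrm{Pre}^{\mathrm{flow}}_l(G)=\{u\in\mathrm{Val}(X)\mid\exists\delta\ge0,\ c\in\mathrm{Flow}(l): u+\delta c\in G\}$. $\mathrm{RWA}^m_l(U,V)=\{u\in\mathrm{Val}(X)\mid\exists f\in\mathrm{Adm}(\langle l,u\rangle),\exists\delta\ge0: f(\delta)\in U$ and $\forall 0\le\delta'<\delta: f(\delta')\in\overline V\cup U\}$.
   Formalization: Flow(l) is assumed nonempty, and activities are continuous and differentiable except at finitely many times, with derivative in Flow(l) wherever it exists; with empty Flow(l) or everywhere differentiable activities the claim fails. *)

theory Defs
  imports "HOL-Analysis.Analysis"
begin

text \<open>
  A valuation of the variables is a vector in \<open>real ^ 'n\<close>, where the index type \<open>'n\<close> plays the role
  of \<open>X\<close>. The library predicate \<open>polyhedron\<close> (finite intersections of closed half-spaces) is not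
  the notion used here: half-spaces may be open, and polyhedra need not be convex.
\<close>

definition affine_halfspace :: "(real ^ 'n) set \<Rightarrow> bool" where
  "affine_halfspace h \<longleftrightarrow>
     (\<exists>a b. a \<noteq> 0 \<and> (h = {x. a \<bullet> x \<le> b} \<or> h = {x. a \<bullet> x < b}))"

definition convex_polyhedral :: "(real ^ 'n) set \<Rightarrow> bool" where
  "convex_polyhedral P \<longleftrightarrow> (\<exists>F. finite F \<and> (\<forall>h\<in>F. affine_halfspace h) \<and> P = \<Inter>F)"

definition polyhedral :: "(real ^ 'n) set \<Rightarrow> bool" where
  "polyhedral G \<longleftrightarrow> (\<exists>F. finite F \<and> (\<forall>P\<in>F. convex_polyhedral P) \<and> G = \<Union>F)"

text \<open>
  A way of representing polyhedra by finite sets of convex polyhedra. The value of \<open>rep\<close> on sets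
  that are not polyhedra is irrelevant.
\<close>

definition representation :: "((real ^ 'n) set \<Rightarrow> (real ^ 'n) set set) \<Rightarrow> bool" where
  "representation rep \<longleftrightarrow>
     (\<forall>G. polyhedral G \<longrightarrow>
        finite (rep G) \<and> (\<forall>P\<in>rep G. convex_polyhedral P) \<and> \<Union>(rep G) = G)"

definition bound :: "(real ^ 'n) set \<Rightarrow> (real ^ 'n) set \<Rightarrow> (real ^ 'n) set" where
  "bound G G' = (closure G \<inter> G') \<union> (G \<inter> closure G')"

text \<open>
  Only the components of a linear hybrid automaton that are needed here are fields of the record;
  the remaining ones (initial states, invariants, edges, \dots) are left to record extension, so a
  result about \<open>lha_scheme\<close> covers every choice of them.
\<close>

record ('l, 'n) lha =
  Loc :: "'l set"
  Flow :: "'l \<Rightarrow> (real ^ 'n) set"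

definition linear_hybrid_automaton :: "('l, 'n::finite, 'z) lha_scheme \<Rightarrow> bool" where
  "linear_hybrid_automaton H \<longleftrightarrow>
     finite (Loc H) \<and> (\<forall>l\<in>Loc H. convex_polyhedral (Flow H l))"

text \<open>
  Activities are continuous and may have finitely many times of non-differentiability; the
  derivative is constrained wherever it exists (at time 0 it is the right derivative). Without such
  switching times a trajectory could not turn a corner of a lower-dimensional polyhedron, as the
  fixpoint characterization of \<open>RWA_may\<close> requires.
\<close>

definition activity :: "(real \<Rightarrow> real ^ 'n) \<Rightarrow> bool" where
  "activity f \<longleftrightarrow>
     continuous_on {0..} f \<and> finite {t \<in> {0..}. \<not> f differentiable (at t within {0..})}"

definition Adm :: "('l, 'n::finite, 'z) lha_scheme \<Rightarrow> 'l \<Rightarrow> real ^ 'n \<Rightarrow> (real \<Rightarrow> real ^ 'n) set" where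
  "Adm H l u =
     {f. activity f \<and> f 0 = u \<and>
         (\<forall>t\<ge>0. f differentiable (at t within {0..}) \<longrightarrow>
                vector_derivative f (at t within {0..}) \<in> Flow H l)}"

definition pre_flow :: "('l, 'n::finite, 'z) lha_scheme \<Rightarrow> 'l \<Rightarrow> (real ^ 'n) set \<Rightarrow> (real ^ 'n) set" where
  "pre_flow H l G = {u. \<exists>\<delta>\<ge>0. \<exists>c\<in>Flow H l. u + \<delta> *\<^sub>R c \<in> G}"

definition RWA_may ::
    "('l, 'n::finite, 'z) lha_scheme \<Rightarrow> 'l \<Rightarrow> (real ^ 'n) set \<Rightarrow> (real ^ 'n) set \<Rightarrow> (real ^ 'n) set" where
  "RWA_may H l U V =
     {u. \<exists>f\<in>Adm H l u. \<exists>\<delta>\<ge>0. f \<delta> \<in> U \<and> (\<forall>\<delta>'. 0 \<le> \<delta>' \<and> \<delta>' < \<delta> \<longrightarrow> f \<delta>' \<in> - V \<union> U)}"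

definition tau ::
    "('l, 'n::finite, 'z) lha_scheme \<Rightarrow> 'l \<Rightarrow> ((real ^ 'n) set \<Rightarrow> (real ^ 'n) set set) \<Rightarrow>
     (real ^ 'n) set \<Rightarrow> (real ^ 'n) set \<Rightarrow> (real ^ 'n) set \<Rightarrow> (real ^ 'n) set" where
  "tau H l rep U V W =
     U \<union> (\<Union>P\<in>rep (- V). \<Union>P'\<in>rep W.
            P \<inter> pre_flow H l (bound P P' \<inter> pre_flow H l P'))"

text \<open>
  Least fixpoint among the members of \<open>D\<close>. The constant \<open>lfp\<close> ranges over all sets, whereas
  \<open>tau\<close> is meaningful only on polyhedra; membership of \<open>X\<close> in \<open>D\<close> is part of the claim.
\<close>

definition least_fixpoint_in :: "'a set set \<Rightarrow> ('a set \<Rightarrow> 'a set) \<Rightarrow> 'a set \<Rightarrow> bool" where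
  "least_fixpoint_in D g X \<longleftrightarrow> X \<in> D \<and> g X = X \<and> (\<forall>Y\<in>D. g Y = Y \<longrightarrow> X \<subseteq> Y)"

end

theory Submission
  imports Defs
begin

text \<open>
  On polyhedra, \<open>tau\<close> agrees with a monotone operator on all sets that does not mention the
  representation of \<open>W\<close>, so it suffices to show that the least fixpoint of that operator is a
  polyhedron and equals \<open>RWA_may\<close>. It is a polyhedron because a run never needs to return to a
  convex piece of the complement of \<open>V\<close> that it has left, which reduces the fixpoint, by induction
  on the set of pieces, to finitely many applications of the operator; these preserve polyhedra by
  Fourier--Motzkin elimination.

  \<open>RWA_may\<close> is closed under the operator because straight segments can be prepended to activities.
  Conversely, let \<open>Y\<close> be a polyhedron that contains \<open>U\<close> and is closed under the operator, and suppose
  that an activity witnessing membership in \<open>RWA_may\<close> starts outside \<open>Y\<close>. Let \<open>s\<close> be the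
  infimum of the times it spends in \<open>Y\<close>. By the pigeonhole principle it is in one fixed convex piece at times accumulating at \<open>s\<close>: a piece of the complement
  of \<open>V\<close> just before \<open>s\<close> if \<open>Y\<close> is attained at \<open>s\<close>, and a piece of \<open>Y\<close> just after \<open>s\<close>
  otherwise. Since difference quotients of activities lie in the convex set of flows, either case
  puts a point outside \<open>Y\<close> into the image of \<open>Y\<close>.
\<close>

subsection \<open>Convex polyhedra in Euclidean spaces and their projections\<close>

text \<open>Unlike \<open>affine_halfspace\<close>, \<open>halfspace\<close> admits the normal vector 0 and works in product spaces,
  which makes the class closed under linear preimages and projections.\<close>

definition halfspace :: "'a::euclidean_space set \<Rightarrow> bool" where
  "halfspace h \<longleftrightarrow> (\<exists>a b. h = {x. a \<bullet> x \<le> b} \<or> h = {x. a \<bullet> x < b})"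

definition hpoly :: "'a::euclidean_space set \<Rightarrow> bool" where
  "hpoly S \<longleftrightarrow> (\<exists>F. finite F \<and> (\<forall>h\<in>F. halfspace h) \<and> S = \<Inter>F)"

lemma halfspaceE:
  assumes "halfspace h"
  obtains a b where "h = {x. a \<bullet> x \<le> b}" | a b where "h = {x. a \<bullet> x < b}"
  using assms unfolding halfspace_def by blast

lemma halfspace_le [intro]: "halfspace {x. a \<bullet> x \<le> b}"
  and halfspace_lt [intro]: "halfspace {x. a \<bullet> x < b}"
  unfolding halfspace_def by blast+

lemma hpoly_halfspace: "halfspace h \<Longrightarrow> hpoly h"
  unfolding hpoly_def by (rule exI[of _ "{h}"]) simp

lemma hpoly_Inter: "finite F \<Longrightarrow> (\<And>S. S \<in> F \<Longrightarrow> hpoly S) \<Longrightarrow> hpoly (\<Inter>F)"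
proof -
  assume "finite F" and "\<And>S. S \<in> F \<Longrightarrow> hpoly S"
  then have "\<forall>S\<in>F. \<exists>G. finite G \<and> (\<forall>h\<in>G. halfspace h) \<and> S = \<Inter>G"
    unfolding hpoly_def by blast
  from bchoice[OF this] obtain G
    where G: "\<And>S. S \<in> F \<Longrightarrow> finite (G S) \<and> (\<forall>h\<in>G S. halfspace h) \<and> S = \<Inter>(G S)"
    by metis
  have "\<Inter>F = \<Inter>((\<lambda>S. \<Inter>(G S)) ` F)"
    using G by simp
  also have "\<dots> = \<Inter>(\<Union>(G ` F))"
    by blast
  finally have "\<Inter>F = \<Inter>(\<Union>(G ` F))" .
  then show ?thesis
    unfolding hpoly_def using G \<open>finite F\<close> by (intro exI[of _ "\<Union>(G ` F)"]) auto
qed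

lemma hpoly_UNIV [simp]: "hpoly UNIV"
  using hpoly_Inter[of "{}"] by simp

lemma hpoly_Int: "hpoly S \<Longrightarrow> hpoly T \<Longrightarrow> hpoly (S \<inter> T)"
  using hpoly_Inter[of "{S, T}"] by auto

lemma hpoly_vimage:
  fixes f :: "'a::euclidean_space \<Rightarrow> 'b::euclidean_space"
  assumes f: "linear f" and S: "hpoly S"
  shows "hpoly (f -` S)"
proof -
  obtain F where F: "finite F" "\<And>h. h \<in> F \<Longrightarrow> halfspace h" "S = \<Inter>F"
    using S unfolding hpoly_def by blast
  have "halfspace (f -` h)" if "h \<in> F" for h
    using F(2)[OF that]
  proof (cases rule: halfspaceE)
    case (1 a b)
    \<comment> \<open>The adjoint moves the map onto the normal vector, which may become 0.\<close>
    then have "f -` h = {x. adjoint f a \<bullet> x \<le> b}"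
      using adjoint_works[OF f] by (auto simp: inner_commute)
    then show ?thesis by auto
  next
    case (2 a b)
    then have "f -` h = {x. adjoint f a \<bullet> x < b}"
      using adjoint_works[OF f] by (auto simp: inner_commute)
    then show ?thesis by auto
  qed
  moreover have "f -` S = \<Inter>((\<lambda>h. f -` h) ` F)"
    using F(3) by blast
  ultimately show ?thesis
    using F(1) by (auto intro: hpoly_Inter hpoly_halfspace)
qed

lemma halfspace_convex: "halfspace h \<Longrightarrow> convex h"
  by (auto elim!: halfspaceE simp: convex_halfspace_le convex_halfspace_lt)

lemma hpoly_convex: "hpoly S \<Longrightarrow> convex S"
  unfolding hpoly_def using halfspace_convex by (auto intro: convex_Inter)

section \<open>Eliminating one real unknown from two linear inequalities\<close>

lemma mult_lower_bound_ex:
  fixes p q r s :: real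
  assumes "p > 0" "q > 0"
  shows "\<exists>t. t * p \<le> r \<and> t * q \<le> s" "\<exists>t. t * p < r \<and> t * q < s"
    "\<exists>t. t * p \<le> r \<and> t * q < s" "\<exists>t. t * p < r \<and> t * q \<le> s"
proof -
  define t where "t = min (r / p) (s / q) - 1"
  have "t < r / p" "t < s / q"
    by (auto simp: t_def)
  then have "t * p < r" "t * q < s"
    using assms by (auto simp: field_simps)
  then show "\<exists>t. t * p \<le> r \<and> t * q \<le> s" "\<exists>t. t * p < r \<and> t * q < s"
    "\<exists>t. t * p \<le> r \<and> t * q < s" "\<exists>t. t * p < r \<and> t * q \<le> s"
    by (auto intro: less_imp_le)
qed

text \<open>The first constraint bounds \<open>t\<close> above by \<open>r / p\<close>, the second
  below by \<open>s / q\<close>. Compatibility of the bounds is multiplied by \<open>p * q\<close>,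
  whose negative sign reverses the inequality. One strict constraint makes the result
  strict.\<close>

lemma between_ex:
  fixes p q r s :: real
  assumes "p > 0" "q < 0"
  shows "(\<exists>t. t * p \<le> r \<and> t * q \<le> s) \<longleftrightarrow> 0 \<le> s * p - r * q"
    "(\<exists>t. t * p < r \<and> t * q < s) \<longleftrightarrow> 0 < s * p - r * q"
    "(\<exists>t. t * p \<le> r \<and> t * q < s) \<longleftrightarrow> 0 < s * p - r * q"
    "(\<exists>t. t * p < r \<and> t * q \<le> s) \<longleftrightarrow> 0 < s * p - r * q"
proof -
  have le: "t * p \<le> r \<longleftrightarrow> t \<le> r / p" "t * q \<le> s \<longleftrightarrow> s / q \<le> t"
    and lt: "t * p < r \<longleftrightarrow> t < r / p" "t * q < s \<longleftrightarrow> s / q < t" for t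
    using assms by (auto simp: field_simps)
  have *: "0 \<le> s * p - r * q \<longleftrightarrow> s / q \<le> r / p" "0 < s * p - r * q \<longleftrightarrow> s / q < r / p"
    using assms by (auto simp: field_simps)
  show "(\<exists>t. t * p \<le> r \<and> t * q \<le> s) \<longleftrightarrow> 0 \<le> s * p - r * q"
    unfolding le * by (meson order.trans order.refl)
  show "(\<exists>t. t * p < r \<and> t * q < s) \<longleftrightarrow> 0 < s * p - r * q"
    unfolding lt * by (meson dense less_trans)
  show "(\<exists>t. t * p \<le> r \<and> t * q < s) \<longleftrightarrow> 0 < s * p - r * q"
    unfolding lt le * by (meson order.refl less_le_trans)
  show "(\<exists>t. t * p < r \<and> t * q \<le> s) \<longleftrightarrow> 0 < s * p - r * q"
    unfolding lt le * by (meson order.refl le_less_trans)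
qed

text \<open>\<open>hrel\<close> merges the strict and the non-strict case, so that one case distinction on the signs
  of the coefficients suffices in the elimination step.\<close>

definition hrel :: "bool \<Rightarrow> real \<Rightarrow> real \<Rightarrow> bool" where
  "hrel s x y \<longleftrightarrow> (if s then x < y else x \<le> y)"

lemma halfspace_iff: "halfspace h \<longleftrightarrow> (\<exists>a b s. h = {x. hrel s (a \<bullet> x) b})"
proof
  assume "halfspace h"
  then show "\<exists>a b s. h = {x. hrel s (a \<bullet> x) b}"
  proof (cases rule: halfspaceE)
    case (1 a b)
    then show ?thesis
      by (intro exI[of _ a] exI[of _ b] exI[of _ False]) (simp add: hrel_def)
  next
    case (2 a b)
    then show ?thesis
      by (intro exI[of _ a] exI[of _ b] exI[of _ True]) (simp add: hrel_def)
  qed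
next
  assume "\<exists>a b s. h = {x. hrel s (a \<bullet> x) b}"
  then obtain a b s where "h = {x. hrel s (a \<bullet> x) b}"
    by blast
  then show "halfspace h"
    by (cases s) (auto simp: hrel_def)
qed

lemma hpoly_hrel: "hpoly {x. hrel s (a \<bullet> x) b}"
  using halfspace_iff hpoly_halfspace by blast

lemma hrel_both_pos:
  assumes "p > 0" "q > 0"
  shows "\<exists>t. hrel s (t * p) r \<and> hrel s' (t * q) r'"
  using mult_lower_bound_ex[OF assms, of r r'] unfolding hrel_def by (cases s; cases s') auto

lemma hrel_pos_neg:
  assumes "p > 0" "q < 0"
  shows "(\<exists>t. hrel s (t * p) r \<and> hrel s' (t * q) r') \<longleftrightarrow> hrel (s \<or> s') 0 (r' * p - r * q)"
  using between_ex[OF assms, of r r'] unfolding hrel_def by (cases s; cases s') auto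

text \<open>A constraint with coefficient 0 does not involve \<open>t\<close>. Otherwise,
  coefficients of equal sign leave \<open>t\<close> free to escape to one side, so only opposite
  signs yield a condition on \<open>x\<close>: the positive combination of the two inequalities in
  which \<open>t\<close> cancels.\<close>

lemma hpoly_eliminate_pair_hrel:
  fixes a a' :: "'a::euclidean_space"
  shows "hpoly {x. \<exists>t::real. hrel s (t * p) (b - a \<bullet> x) \<and> hrel s' (t * q) (b' - a' \<bullet> x)}"
    (is "hpoly ?S")
proof -
  have half: "hpoly {x. hrel r 0 (c - d \<bullet> x)}" for r c and d :: 'a
    using hpoly_hrel[of r d c] by (cases r) (simp_all add: hrel_def)
  have one: "\<exists>t. hrel r (t * m) c" if "m \<noteq> 0" for r m c
  proof -
    have "(c - 1) / m * m < c"
      using that by simp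
    then show ?thesis
      unfolding hrel_def by (cases r) (meson less_imp_le)+
  qed
  have opp: "hpoly {x. \<exists>t::real. hrel s (t * p) (b - a \<bullet> x) \<and> hrel s' (t * q) (b' - a' \<bullet> x)}"
    if "p > 0" "q < 0" for s s' p q b b' and a a' :: 'a
  proof -
    have "(b' - a' \<bullet> x) * p - (b - a \<bullet> x) * q = (b' * p - b * q) - (p *\<^sub>R a' - q *\<^sub>R a) \<bullet> x" for x
      by (simp add: algebra_simps inner_diff_left)
    then show ?thesis
      unfolding hrel_pos_neg[OF that] using half by simp
  qed
  consider "p = 0" "q = 0" | "p = 0" "q \<noteq> 0" | "p \<noteq> 0" "q = 0" | "p > 0" "q > 0"
    | "p < 0" "q < 0" | "p > 0" "q < 0" | "p < 0" "q > 0"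
    by linarith
  then show ?thesis
  proof cases
    case 1
    then have "?S = {x. hrel s 0 (b - a \<bullet> x)} \<inter> {x. hrel s' 0 (b' - a' \<bullet> x)}"
      by auto
    then show ?thesis using half by (auto intro!: hpoly_Int)
  next
    case 2
    then have "?S = {x. hrel s 0 (b - a \<bullet> x)}"
      using one by auto
    then show ?thesis using half by simp
  next
    case 3
    then have "?S = {x. hrel s' 0 (b' - a' \<bullet> x)}"
      using one by auto
    then show ?thesis using half by simp
  next
    case 4
    then have "?S = UNIV"
      using hrel_both_pos by auto
    then show ?thesis by simp
  next
    case 5
    have "\<exists>t. hrel s (t * p) r \<and> hrel s' (t * q) r'" for r r'
    proof -
      obtain t where "hrel s (t * - p) r \<and> hrel s' (t * - q) r'"
        using hrel_both_pos[of "- p" "- q" s r s' r'] 5 by auto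
      then show ?thesis
        by (intro exI[of _ "- t"]) simp
    qed
    then have "?S = UNIV"
      by auto
    then show ?thesis by simp
  next
    case 6
    then show ?thesis by (rule opp)
  next
    case 7
    have "?S = {x. \<exists>t::real. hrel s' (t * q) (b' - a' \<bullet> x) \<and> hrel s (t * p) (b - a \<bullet> x)}"
      by auto
    then show ?thesis using opp[OF 7(2,1)] by simp
  qed
qed

lemma hpoly_eliminate_pair:
  fixes h h' :: "'a::euclidean_space set"
  assumes "halfspace h" "halfspace h'"
  shows "hpoly {x. \<exists>t. x + t *\<^sub>R e \<in> h \<inter> h'}"
proof -
  obtain a b s where h: "h = {x. hrel s (a \<bullet> x) b}"
    using assms halfspace_iff by blast
  obtain a' b' s' where h': "h' = {x. hrel s' (a' \<bullet> x) b'}"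
    using assms halfspace_iff by blast
  have "hrel s (c \<bullet> (x + t *\<^sub>R e)) r \<longleftrightarrow> hrel s (t * (c \<bullet> e)) (r - c \<bullet> x)" for c x t r s
    by (auto simp: hrel_def inner_add_right)
  then show ?thesis
    using hpoly_eliminate_pair_hrel[of s "a \<bullet> e" b a s' "a' \<bullet> e" b' a'] by (simp add: h h')
qed

text \<open>In dimension 1 Helly's theorem inspects pairs, but it requires at least two sets. For a
  single set the case \<open>S = T\<close> of the last assumption gives nonemptiness.\<close>

lemma helly_real:
  fixes F :: "real set set"
  assumes "finite F" "\<And>S. S \<in> F \<Longrightarrow> convex S" "\<And>S T. S \<in> F \<Longrightarrow> T \<in> F \<Longrightarrow> S \<inter> T \<noteq> {}"
  shows "\<Inter>F \<noteq> {}"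
proof (cases "card F \<ge> 2")
  case True
  show ?thesis
  proof (rule Helly)
    show "DIM(real) + 1 \<le> card F"
      using True by simp
    show "\<forall>s\<in>F. convex s"
      using assms by blast
    show "\<Inter>t \<noteq> {}" if "t \<subseteq> F" "card t = DIM(real) + 1" for t
    proof -
      obtain S T where "t = {S, T}"
        using \<open>card t = _\<close> by (auto simp: card_Suc_eq numeral_2_eq_2)
      then show ?thesis
        using assms(3) \<open>t \<subseteq> F\<close> by auto
    qed
  qed
next
  case False
  then consider "F = {}" | S where "F = {S}"
    using assms(1) by (metis One_nat_def card_0_eq card_1_singletonE less_2_cases not_le_imp_less)
  then show ?thesis
    by cases (use assms(3) in auto)
qed

text \<open>Fourier--Motzkin: by Helly's theorem on the line it is enough to eliminate from pairs of
  half-spaces.\<close>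

lemma hpoly_eliminate:
  fixes S :: "'a::euclidean_space set"
  assumes "hpoly S"
  shows "hpoly {x. \<exists>t. x + t *\<^sub>R e \<in> S}"
proof -
  obtain F where F: "finite F" "\<And>h. h \<in> F \<Longrightarrow> halfspace h" "S = \<Inter>F"
    using assms unfolding hpoly_def by blast
  let ?E = "\<lambda>(h, h'). {x. \<exists>t. x + t *\<^sub>R e \<in> h \<inter> h'}"
  have "(\<exists>t. x + t *\<^sub>R e \<in> S) \<longleftrightarrow> x \<in> \<Inter>(?E ` (F \<times> F))" for x
  proof
    assume "x \<in> \<Inter>(?E ` (F \<times> F))"
    then have ex: "\<exists>t. x + t *\<^sub>R e \<in> h \<inter> h'" if "h \<in> F" "h' \<in> F" for h h'
      using that by force
    let ?L = "\<lambda>h. {t. x + t *\<^sub>R e \<in> h}"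
    have "\<Inter>(?L ` F) \<noteq> {}"
    proof (rule helly_real)
      show "finite (?L ` F)"
        using F(1) by simp
      show "convex T" if "T \<in> ?L ` F" for T
      proof -
        obtain h where h: "h \<in> F" "T = ?L h"
          using \<open>T \<in> ?L ` F\<close> by (rule imageE)
        \<comment> \<open>The parameters of the line that hit \<open>h\<close> form a linear
          preimage of a translate of \<open>h\<close>.\<close>
        have "convex ((\<lambda>t. t *\<^sub>R e) -` ((+) (- x) ` h))"
          using halfspace_convex[OF F(2)[OF h(1)]]
          by (intro convex_linear_vimage convex_translation) (auto simp: linear_iff algebra_simps)
        moreover have "(\<lambda>t. t *\<^sub>R e) -` ((+) (- x) ` h) = T"
          unfolding h(2) by (auto simp: image_iff algebra_simps)
        ultimately show ?thesis by simp
      qed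
      show "T \<inter> T' \<noteq> {}" if "T \<in> ?L ` F" "T' \<in> ?L ` F" for T T'
        using that ex by fast
    qed
    then show "\<exists>t. x + t *\<^sub>R e \<in> S"
      using F(3) by auto
  qed (use F(3) in auto)
  then have "{x. \<exists>t. x + t *\<^sub>R e \<in> S} = \<Inter>(?E ` (F \<times> F))"
    by blast
  also have "hpoly \<dots>"
  proof (rule hpoly_Inter)
    show "hpoly T" if T: "T \<in> ?E ` (F \<times> F)" for T
    proof -
      obtain h h' where "h \<in> F" "h' \<in> F" "T = {x. \<exists>t. x + t *\<^sub>R e \<in> h \<inter> h'}"
        using T by auto
      then show ?thesis
        using hpoly_eliminate_pair[OF F(2) F(2)] by simp
    qed
  qed (use F(1) in simp)
  finally show ?thesis .
qed

text \<open>Eliminates the directions in \<open>B\<close> one after the other.\<close>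

lemma hpoly_add_span:
  fixes S :: "'a::euclidean_space set"
  assumes "finite B" "hpoly S"
  shows "hpoly {x. \<exists>y\<in>span B. x + y \<in> S}"
  using assms(1)
proof (induction B rule: finite_induct)
  case empty
  then show ?case using assms(2) by simp
next
  case (insert e B)
  have "{x. \<exists>y\<in>span (insert e B). x + y \<in> S} = {x. \<exists>t. x + t *\<^sub>R e \<in> {x. \<exists>y\<in>span B. x + y \<in> S}}"
  proof (intro set_eqI iffI; clarsimp)
    fix x y assume "y \<in> span (insert e B)" "x + y \<in> S"
    moreover from this obtain k where "y - k *\<^sub>R e \<in> span B"
      using span_breakdown_eq by blast
    ultimately show "\<exists>t. \<exists>y\<in>span B. x + t *\<^sub>R e + y \<in> S"
      by (intro exI[of _ k] bexI[of _ "y - k *\<^sub>R e"]) auto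
  next
    fix x t y assume "y \<in> span B" "x + t *\<^sub>R e + y \<in> S"
    moreover from this have "t *\<^sub>R e + y \<in> span (insert e B)"
      by (meson insertI1 span_add span_base span_mono span_mul subset_insertI subsetD)
    ultimately show "\<exists>y\<in>span (insert e B). x + y \<in> S"
      by (intro bexI[of _ "t *\<^sub>R e + y"]) (auto simp: add.assoc)
  qed
  then show ?case
    using hpoly_eliminate[OF insert.IH] by simp
qed

text \<open>A projection is an elimination of all basis directions of the second factor, followed by
  restriction to second component 0.\<close>

lemma hpoly_fst_image:
  fixes S :: "('a::euclidean_space \<times> 'b::euclidean_space) set"
  assumes "hpoly S"
  shows "hpoly (fst ` S)"
proof -
  let ?i = "\<lambda>y::'b. (0::'a, y)"
  have lin: "linear ?i" "linear (\<lambda>x::'a. (x, 0::'b))"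
    by (auto simp: linear_iff)
  have "span (?i ` Basis) = range ?i"
    using linear_span_image[OF lin(1), of Basis] by simp
  then have "fst ` S = (\<lambda>x. (x, 0)) -` {x. \<exists>y\<in>span (?i ` Basis). x + y \<in> S}"
    by force
  also have "hpoly \<dots>"
    using assms by (intro hpoly_vimage lin hpoly_add_span) auto
  finally show ?thesis .
qed

section \<open>Segments and closures\<close>

lemma halfspace_segment:
  assumes "halfspace h" "p \<in> h" "x \<in> closure h" "0 < t" "t \<le> 1"
  shows "x + t *\<^sub>R (p - x) \<in> h"
  using assms(1)
proof (cases rule: halfspaceE)
  case (1 a b)
  then have "closed h"
    by (simp add: closed_halfspace_le)
  then have "a \<bullet> x \<le> b" "a \<bullet> p \<le> b"
    using 1 assms by auto
  moreover have "a \<bullet> (x + t *\<^sub>R (p - x)) = (1 - t) * (a \<bullet> x) + t * (a \<bullet> p)"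
    by (simp add: algebra_simps inner_add_right inner_diff_right)
  ultimately show ?thesis
    using assms convex_bound_le[of "a \<bullet> x" b "a \<bullet> p" "1 - t" t] by (simp add: 1)
next
  case (2 a b)
  have "closure h \<subseteq> {x. a \<bullet> x \<le> b}"
    using 2 by (intro closure_minimal) (auto simp: closed_halfspace_le)
  then have "a \<bullet> x \<le> b" "a \<bullet> p < b"
    using 2 assms by auto
  moreover have "a \<bullet> (x + t *\<^sub>R (p - x)) = (1 - t) * (a \<bullet> x) + t * (a \<bullet> p)"
    by (simp add: algebra_simps inner_add_right inner_diff_right)
  \<comment> \<open>The weight \<open>t\<close> of \<open>p\<close> is positive, so strictness at
    \<open>p\<close> survives although \<open>x\<close> may lie on the boundary.\<close>
  moreover have "(1 - t) * (a \<bullet> x) \<le> (1 - t) * b" "t * (a \<bullet> p) < t * b"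
    using calculation assms by (auto intro!: mult_left_mono)
  ultimately have "a \<bullet> (x + t *\<^sub>R (p - x)) < (1 - t) * b + t * b"
    by linarith
  then show ?thesis
    by (simp add: 2 algebra_simps)
qed

lemma hpoly_segment:
  assumes "hpoly S" "p \<in> S" "x \<in> closure S" "0 < t" "t \<le> 1"
  shows "x + t *\<^sub>R (p - x) \<in> S"
proof -
  obtain F where F: "\<And>h. h \<in> F \<Longrightarrow> halfspace h" "S = \<Inter>F"
    using assms(1) unfolding hpoly_def by blast
  have "x \<in> closure h" if "h \<in> F" for h
    using that assms(3) F(2) closure_mono[of S h] by blast
  then show ?thesis
    using F assms halfspace_segment by blast
qed

lemma halfspace_closure: "halfspace h \<Longrightarrow> halfspace (closure h)"
proof (elim halfspaceE)
  fix a :: 'a and b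
  assume "h = {x. a \<bullet> x \<le> b}"
  then show "halfspace (closure h)"
    using closure_closed[OF closed_halfspace_le[of a b]] by auto
next
  fix a :: 'a and b
  assume h: "h = {x. a \<bullet> x < b}"
  show "halfspace (closure h)"
  proof (cases "a = 0")
    case True
    \<comment> \<open>With normal 0 the set is empty or the whole space, hence closed.\<close>
    then have "closure h = h"
      using h by auto
    then show ?thesis using h by auto
  next
    case False
    then show ?thesis using h by (auto simp: closure_halfspace_lt)
  qed
qed

lemma hpoly_empty: "hpoly {}"
  using hpoly_halfspace[OF halfspace_lt[of 0 0]] by simp

text \<open>Closure commutes with the intersection because the half-spaces share a point
  \<open>p\<close>: from any point in all the closures, the segment towards \<open>p\<close> enters
  every half-space at once.\<close>

lemma hpoly_closure:
  assumes "hpoly S"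
  shows "hpoly (closure S)"
proof (cases "S = {}")
  case True
  then show ?thesis by (simp add: hpoly_empty)
next
  case False
  then obtain p where p: "p \<in> S"
    by blast
  obtain F where F: "finite F" "\<And>h. h \<in> F \<Longrightarrow> halfspace h" "S = \<Inter>F"
    using assms unfolding hpoly_def by blast
  have "x \<in> closure S" if x: "x \<in> \<Inter>(closure ` F)" for x
  proof -
    have "x + t *\<^sub>R (p - x) \<in> S" if "0 < t" "t \<le> 1" for t
      using halfspace_segment F p x that by blast
    then have "x + inverse (real (Suc n)) *\<^sub>R (p - x) \<in> S" for n
      by (auto simp: divide_simps)
    moreover have "(\<lambda>n. x + inverse (real (Suc n)) *\<^sub>R (p - x)) \<longlonglongrightarrow> x + 0 *\<^sub>R (p - x)"
      by (intro tendsto_intros LIMSEQ_inverse_real_of_nat)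
    ultimately show ?thesis
      unfolding closure_sequential
      by (intro exI[of _ "\<lambda>n. x + inverse (real (Suc n)) *\<^sub>R (p - x)"]) auto
  qed
  moreover have "closure S \<subseteq> \<Inter>(closure ` F)"
    using F(3) closure_mono by (metis INF_greatest Inter_lower)
  ultimately have "closure S = \<Inter>(closure ` F)"
    by blast
  also have "hpoly \<dots>"
    using F by (auto intro: hpoly_Inter hpoly_halfspace halfspace_closure)
  finally show ?thesis .
qed

section \<open>Predecessors along straight segments\<close>

definition pre :: "'a::real_vector set \<Rightarrow> 'a set \<Rightarrow> 'a set" where
  "pre C G = {u. \<exists>\<delta>\<ge>0. \<exists>c\<in>C. u + \<delta> *\<^sub>R c \<in> G}"

lemma pre_flow_eq: "pre_flow H l = pre (Flow H l)"
  by (simp add: pre_flow_def pre_def fun_eq_iff)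

text \<open>Homogenization: the displacement \<open>\<delta> *\<^sub>R c\<close> is bilinear in time
  and slope, but in terms of displacement \<open>d\<close> and time \<delta> a constraint on the
  slope becomes linear after multiplication by \<delta> > 0.\<close>

lemma hpoly_cone:
  fixes C :: "'a::euclidean_space set"
  assumes "hpoly C"
  shows "hpoly {(d, \<delta>). \<delta> > 0 \<and> inverse \<delta> *\<^sub>R d \<in> C}"
proof -
  obtain F where F: "finite F" "\<And>h. h \<in> F \<Longrightarrow> halfspace h" "C = \<Inter>F"
    using assms unfolding hpoly_def by blast
  have "\<exists>k. halfspace k \<and> (\<forall>d \<delta>. \<delta> > 0 \<longrightarrow> ((d, \<delta>) \<in> k \<longleftrightarrow> inverse \<delta> *\<^sub>R d \<in> h))" if "h \<in> F" for h
    using F(2)[OF that]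
  proof (cases rule: halfspaceE)
    case (1 a b)
    show ?thesis
      by (rule exI[of _ "{x. (a, - b) \<bullet> x \<le> 0}"]) (auto simp: 1 field_simps)
  next
    case (2 a b)
    show ?thesis
      by (rule exI[of _ "{x. (a, - b) \<bullet> x < 0}"]) (auto simp: 2 field_simps)
  qed
  then obtain k where k: "\<And>h. h \<in> F \<Longrightarrow> halfspace (k h)"
    "\<And>h d \<delta>. h \<in> F \<Longrightarrow> \<delta> > 0 \<Longrightarrow> (d, \<delta>) \<in> k h \<longleftrightarrow> inverse \<delta> *\<^sub>R d \<in> h"
    by metis
  have "{(d, \<delta>). \<delta> > 0 \<and> inverse \<delta> *\<^sub>R d \<in> C} = {x. (0, - 1) \<bullet> x < 0} \<inter> \<Inter>(k ` F)"
    using k(2) F(3) by auto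
  also have "hpoly \<dots>"
    using k(1) F(1) by (intro hpoly_Int hpoly_Inter hpoly_halfspace[OF halfspace_lt]) (auto intro: hpoly_halfspace)
  finally show ?thesis .
qed

text \<open>Time 0 contributes \<open>G\<close> itself. Positive times contribute the projection to
  \<open>u\<close> of a convex polyhedron of triples of start, displacement and duration.\<close>

lemma pre_hpoly:
  fixes C G :: "'a::euclidean_space set"
  assumes C: "hpoly C" "C \<noteq> {}" and G: "hpoly G"
  shows "\<exists>G'. hpoly G' \<and> pre C G = G \<union> G'"
proof -
  let ?T = "{x::'a \<times> ('a \<times> real). snd x \<in> {(d, \<delta>). \<delta> > 0 \<and> inverse \<delta> *\<^sub>R d \<in> C}} \<inter>
    {x. fst x + fst (snd x) \<in> G}"
  have "hpoly (snd -` {(d, \<delta>). \<delta> > 0 \<and> inverse \<delta> *\<^sub>R d \<in> C} \<inter>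
      (\<lambda>x::'a \<times> ('a \<times> real). fst x + fst (snd x)) -` G)"
    using C G by (intro hpoly_Int hpoly_vimage hpoly_cone) (auto simp: linear_iff algebra_simps)
  then have T: "hpoly ?T"
    by (simp add: vimage_def)
  have "pre C G = G \<union> fst ` ?T"
  proof (intro set_eqI iffI)
    fix u assume "u \<in> pre C G"
    then obtain \<delta> c where d: "\<delta> \<ge> 0" "c \<in> C" "u + \<delta> *\<^sub>R c \<in> G"
      unfolding pre_def by blast
    show "u \<in> G \<union> fst ` ?T"
    proof (cases "\<delta> = 0")
      case False
      then have "(u, \<delta> *\<^sub>R c, \<delta>) \<in> ?T"
        using d False by simp
      then show ?thesis by (intro UnI2 image_eqI[of _ _ "(u, \<delta> *\<^sub>R c, \<delta>)"]) (simp_all only: fst_conv)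
    qed (use d in auto)
  next
    fix u assume "u \<in> G \<union> fst ` ?T"
    then consider "u \<in> G" | d \<delta> where "\<delta> > 0" "inverse \<delta> *\<^sub>R d \<in> C" "u + d \<in> G"
      by auto
    then show "u \<in> pre C G"
    proof cases
      case 1
      then show ?thesis
        unfolding pre_def using C(2) by (auto intro!: exI[of _ 0])
    next
      case 2
      then show ?thesis
        unfolding pre_def by (auto intro!: exI[of _ \<delta>] bexI[of _ "inverse \<delta> *\<^sub>R d"])
    qed
  qed
  then show ?thesis
    using hpoly_fst_image[OF T] by blast
qed

lemma pre_Union: "pre C (\<Union>F) = (\<Union>P\<in>F. pre C P)"
  unfolding pre_def by blast

lemma pre_mono: "G \<subseteq> G' \<Longrightarrow> pre C G \<subseteq> pre C G'"
  unfolding pre_def by blast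

lemma pre_superset: "C \<noteq> {} \<Longrightarrow> G \<subseteq> pre C G"
  unfolding pre_def by (auto intro!: exI[of _ 0])

text \<open>Two consecutive straight moves have the same effect as one move of total duration whose
  slope is the average weighted by the durations.\<close>

lemma pre_pre:
  assumes "convex C"
  shows "pre C (pre C G) \<subseteq> pre C G"
proof
  fix u assume "u \<in> pre C (pre C G)"
  then obtain d c e c' where d: "d \<ge> 0" "e \<ge> 0" "c \<in> C" "c' \<in> C"
    and g: "u + d *\<^sub>R c + e *\<^sub>R c' \<in> G"
    unfolding pre_def by blast
  show "u \<in> pre C G"
  proof (cases "d + e = 0")
    case True
    then have "d = 0" "e = 0"
      using d by auto
    then show ?thesis
      using d g unfolding pre_def by (auto intro!: exI[of _ 0])
  next
    case False
    let ?c = "(d / (d + e)) *\<^sub>R c + (e / (d + e)) *\<^sub>R c'"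
    have "?c \<in> C"
      using assms d False by (intro convexD) (auto simp: add_divide_distrib[symmetric])
    moreover have "(d + e) *\<^sub>R ?c = d *\<^sub>R c + e *\<^sub>R c'"
      using False by (simp add: scaleR_add_right)
    ultimately show ?thesis
      using d g unfolding pre_def by (auto intro!: exI[of _ "d + e"] bexI[of _ ?c] simp: add.assoc)
  qed
qed

lemma convex_polyhedral_iff:
  fixes S :: "(real ^ 'n) set"
  shows "convex_polyhedral S \<longleftrightarrow> hpoly S"
proof
  assume "convex_polyhedral S"
  moreover have "affine_halfspace h \<Longrightarrow> halfspace h" for h :: "(real ^ 'n) set"
    unfolding affine_halfspace_def halfspace_def by blast
  ultimately show "hpoly S"
    unfolding convex_polyhedral_def hpoly_def by metis
next
  assume "hpoly S"
  then obtain F where F: "finite F" "\<And>h. h \<in> F \<Longrightarrow> halfspace h" "S = \<Inter>F"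
    unfolding hpoly_def by blast
  show "convex_polyhedral S"
  proof (cases "S = {}")
    case True
    \<comment> \<open>Any nonzero normal works: the two opposite open half-spaces through the origin
      are disjoint.\<close>
    let ?a = "1 :: real ^ 'n"
    have "?a \<noteq> 0"
      by simp
    then have "affine_halfspace {x. ?a \<bullet> x < 0}" "affine_halfspace {x. (- ?a) \<bullet> x < 0}"
      unfolding affine_halfspace_def by (metis neg_equal_0_iff_equal)+
    moreover have "S = \<Inter>{{x. ?a \<bullet> x < 0}, {x. (- ?a) \<bullet> x < 0}}"
      using True by auto
    ultimately show ?thesis
      unfolding convex_polyhedral_def
      by (intro exI[of _ "{{x. ?a \<bullet> x < 0}, {x. (- ?a) \<bullet> x < 0}}"]) auto
  next
    case False
    have "affine_halfspace h" if "h \<in> F - {UNIV}" for h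
    proof -
      have "halfspace h" "h \<noteq> UNIV" "h \<noteq> {}"
        using that F False by auto
      then show ?thesis
      proof (elim halfspaceE)
        fix a b
        assume *: "h = {x. a \<bullet> x \<le> b}" "h \<noteq> UNIV" "h \<noteq> {}"
        then have "a \<noteq> 0"
          by (cases "b \<ge> 0") auto
        then show ?thesis
          using * unfolding affine_halfspace_def by blast
      next
        fix a b
        assume *: "h = {x. a \<bullet> x < b}" "h \<noteq> UNIV" "h \<noteq> {}"
        then have "a \<noteq> 0"
          by (cases "b > 0") auto
        then show ?thesis
          using * unfolding affine_halfspace_def by blast
      qed
    qed
    moreover have "S = \<Inter>(F - {UNIV})"
      using F(3) by blast
    ultimately show ?thesis
      unfolding convex_polyhedral_def using F(1) by (metis finite_Diff)
  qed
qed

subsection \<open>Polyhedra\<close>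

lemma polyhedral_iff: "polyhedral G \<longleftrightarrow> (\<exists>F. finite F \<and> (\<forall>P\<in>F. hpoly P) \<and> G = \<Union>F)"
  by (simp add: polyhedral_def convex_polyhedral_iff)

lemma polyhedral_hpoly: "hpoly P \<Longrightarrow> polyhedral P"
  unfolding polyhedral_iff by (rule exI[of _ "{P}"]) simp

lemma polyhedral_Un:
  assumes "polyhedral G" "polyhedral G'"
  shows "polyhedral (G \<union> G')"
proof -
  obtain F F' where "finite F" "\<forall>P\<in>F. hpoly P" "G = \<Union>F" "finite F'" "\<forall>P\<in>F'. hpoly P" "G' = \<Union>F'"
    using assms unfolding polyhedral_iff by blast
  then show ?thesis
    unfolding polyhedral_iff by (intro exI[of _ "F \<union> F'"]) auto
qed

lemma polyhedral_Int:
  assumes "polyhedral G" "polyhedral G'"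
  shows "polyhedral (G \<inter> G')"
proof -
  obtain F F' where "finite F" "\<forall>P\<in>F. hpoly P" "G = \<Union>F" "finite F'" "\<forall>P\<in>F'. hpoly P" "G' = \<Union>F'"
    using assms unfolding polyhedral_iff by blast
  then show ?thesis
    unfolding polyhedral_iff
    by (intro exI[of _ "(\<lambda>(P, P'). P \<inter> P') ` (F \<times> F')"]) (auto intro: hpoly_Int)
qed

lemma polyhedral_UN: "finite I \<Longrightarrow> (\<And>i. i \<in> I \<Longrightarrow> polyhedral (G i)) \<Longrightarrow> polyhedral (\<Union>i\<in>I. G i)"
  by (induction I rule: finite_induct) (auto intro: polyhedral_Un polyhedral_hpoly hpoly_empty)

lemma polyhedral_INT: "finite I \<Longrightarrow> (\<And>i. i \<in> I \<Longrightarrow> polyhedral (G i)) \<Longrightarrow> polyhedral (\<Inter>i\<in>I. G i)"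
  by (induction I rule: finite_induct) (auto intro: polyhedral_Int polyhedral_hpoly)

lemma halfspace_Compl: "halfspace h \<Longrightarrow> halfspace (- h)"
proof (elim halfspaceE)
  fix a :: 'a and b
  assume "h = {x. a \<bullet> x \<le> b}"
  then have "- h = {x. (- a) \<bullet> x < - b}"
    by auto
  then show "halfspace (- h)" by (simp only: halfspace_lt)
next
  fix a :: 'a and b
  assume "h = {x. a \<bullet> x < b}"
  then have "- h = {x. (- a) \<bullet> x \<le> - b}"
    by auto
  then show "halfspace (- h)" by (simp only: halfspace_le)
qed

lemma polyhedral_Compl:
  assumes "polyhedral G"
  shows "polyhedral (- G)"
proof -
  have *: "polyhedral (- P)" if "hpoly P" for P :: "(real ^ 'n) set"
  proof -
    obtain F where F: "finite F" "\<And>h. h \<in> F \<Longrightarrow> halfspace h" "P = \<Inter>F"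
      using \<open>hpoly P\<close> unfolding hpoly_def by blast
    have "- P = (\<Union>h\<in>F. - h)"
      using F(3) by blast
    then show ?thesis
      using F(1,2) by (simp add: polyhedral_UN polyhedral_hpoly hpoly_halfspace halfspace_Compl)
  qed
  obtain F where F: "finite F" "\<forall>P\<in>F. hpoly P" "G = \<Union>F"
    using assms unfolding polyhedral_iff by blast
  have "- G = (\<Inter>P\<in>F. - P)"
    using F(3) by blast
  then show ?thesis
    using F by (simp add: polyhedral_INT *)
qed

lemma polyhedral_pre:
  assumes "hpoly C" "C \<noteq> {}" "polyhedral G"
  shows "polyhedral (pre C G)"
proof -
  obtain F where F: "finite F" "\<forall>P\<in>F. hpoly P" "G = \<Union>F"
    using assms unfolding polyhedral_iff by blast
  have "polyhedral (pre C P)" if "P \<in> F" for P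
    using pre_hpoly[OF assms(1,2), of P] F(2) that
      by (auto simp: polyhedral_Un polyhedral_hpoly)
  then show ?thesis
    unfolding F(3) pre_Union using F(1) by (rule polyhedral_UN[rotated])
qed

lemma polyhedral_bound: "hpoly P \<Longrightarrow> hpoly P' \<Longrightarrow> polyhedral (bound P P')"
  unfolding bound_def by (intro polyhedral_Un polyhedral_hpoly hpoly_Int hpoly_closure)

subsection \<open>The fixpoint operator\<close>

text \<open>\<open>enter\<close> and \<open>through\<close> express \<open>tau\<close> without referring to a representation of \<open>W\<close>. In this
  form the operator is monotone on arbitrary sets.\<close>

definition enter :: "'a::real_normed_vector set \<Rightarrow> 'a set \<Rightarrow> 'a set \<Rightarrow> 'a set" where
  "enter C P W =
     {v \<in> closure P. v \<in> W \<or> v \<in> P \<and> (\<exists>c\<in>C. \<exists>e>0. \<forall>t\<in>{0<..e}. v + t *\<^sub>R c \<in> W)}"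

definition through :: "'a::real_normed_vector set \<Rightarrow> 'a set \<Rightarrow> 'a set \<Rightarrow> 'a set" where
  "through C P W = P \<inter> pre C (enter C P W)"

text \<open>The pigeonhole principle over finitely many pieces yields membership only frequently,
  not eventually; this is enough to locate the limit.\<close>

lemma frequently_closure:
  assumes "(f \<longlongrightarrow> x) F" "\<exists>\<^sub>F t in F. f t \<in> S"
  shows "x \<in> closure S"
proof (rule ccontr)
  assume "x \<notin> closure S"
  then have "\<forall>\<^sub>F t in F. f t \<in> - closure S"
    by (intro topological_tendstoD[OF assms(1)]) auto
  then have "\<forall>\<^sub>F t in F. f t \<notin> S"
    by (rule eventually_mono) (use closure_subset in auto)
  then show False
    using assms(2) by (simp add: frequently_def)
qed

text \<open>This removes the representation: the left side depends on the union alone. A ray that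
  starts inside the union meets one piece at arbitrarily small times, so \<open>v\<close> is in its
  closure; conversely, by convexity, a closure point of a piece stays in that piece on its way to
  any point of it.\<close>

lemma enter_Union:
  fixes C :: "'a::euclidean_space set"
  assumes F: "finite F" "\<forall>P'\<in>F. hpoly P'" and C: "C \<noteq> {}"
  shows "enter C P (\<Union>F) = (\<Union>P'\<in>F. (closure P \<inter> P' \<union> P \<inter> closure P') \<inter> pre C P')"
proof (intro set_eqI iffI)
  fix v assume "v \<in> enter C P (\<Union>F)"
  then consider P' where "v \<in> closure P" "P' \<in> F" "v \<in> P'"
    | c e where "v \<in> P" "c \<in> C" "e > 0" "\<And>t. t \<in> {0<..e} \<Longrightarrow> v + t *\<^sub>R c \<in> \<Union>F"
    unfolding enter_def by blast
  then show "v \<in> (\<Union>P'\<in>F. (closure P \<inter> P' \<union> P \<inter> closure P') \<inter> pre C P')"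
  proof cases
    case 1
    then show ?thesis
      using pre_superset[OF C, of P'] by blast
  next
    case 2
    have "\<forall>\<^sub>F t in at_right 0. \<exists>P'\<in>F. v + t *\<^sub>R c \<in> P'"
      unfolding eventually_at_right_field using 2(3,4) by (intro exI[of _ e]) auto
    then have "\<exists>\<^sub>F t in at_right 0. \<exists>P'\<in>F. v + t *\<^sub>R c \<in> P'"
      by (intro eventually_frequently) auto
    from frequently_bex_finite[OF F(1) this]
    obtain P' where P': "P' \<in> F" "\<exists>\<^sub>F t in at_right 0. v + t *\<^sub>R c \<in> P'"
      by blast
    have "((\<lambda>t. v + t *\<^sub>R c) \<longlongrightarrow> v + 0 *\<^sub>R c) (at_right 0)"
      by (intro tendsto_intros)
    then have "v \<in> closure P'"
      using frequently_closure[OF _ P'(2)] by simp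
    moreover have "\<exists>\<^sub>F t in at_right 0. v + t *\<^sub>R c \<in> P' \<and> t > 0"
      using P'(2) eventually_at_right_less[of 0] by (rule frequently_eventually_frequently)
    then have "v \<in> pre C P'"
      using 2(2) unfolding pre_def by (auto dest!: frequently_ex intro: less_imp_le)
    ultimately show ?thesis
      using 2(1) P'(1) by blast
  qed
next
  fix v assume "v \<in> (\<Union>P'\<in>F. (closure P \<inter> P' \<union> P \<inter> closure P') \<inter> pre C P')"
  then obtain P' where P': "P' \<in> F" "v \<in> closure P \<inter> P' \<union> P \<inter> closure P'" "v \<in> pre C P'"
    by blast
  show "v \<in> enter C P (\<Union>F)"
  proof (cases "v \<in> P'")
    case True
    then show ?thesis
      using P'(1,2) closure_subset unfolding enter_def by auto
  next
    case False
    then have v: "v \<in> P" "v \<in> closure P'"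
      using P' by auto
    obtain d c where d: "d \<ge> 0" "c \<in> C" "v + d *\<^sub>R c \<in> P'"
      using P'(3) unfolding pre_def by blast
    have "d > 0"
      using d False by (cases "d = 0") auto
    \<comment> \<open>The whole segment after \<open>v\<close>, up to the known point of
      \<open>P'\<close>, lies in \<open>P'\<close>, so \<open>d\<close> itself serves as the length
      of the interval.\<close>
    have "v + t *\<^sub>R c \<in> P'" if "t \<in> {0<..d}" for t
      using hpoly_segment[OF F(2)[rule_format, OF P'(1)] d(3) v(2), of "t / d"] that \<open>d > 0\<close> by simp
    then show ?thesis
      using v d \<open>d > 0\<close> P'(1) closure_subset unfolding enter_def by blast
  qed
qed

lemma through_Union:
  fixes C :: "(real ^ 'n) set"
  assumes "finite F" "\<forall>P'\<in>F. hpoly P'" "C \<noteq> {}"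
  shows "through C P (\<Union>F) = (\<Union>P'\<in>F. P \<inter> pre C (bound P P' \<inter> pre C P'))"
  unfolding through_def enter_Union[OF assms] bound_def pre_Union by (simp add: image_image)

lemma polyhedral_through:
  assumes "hpoly C" "C \<noteq> {}" "hpoly P" "polyhedral W"
  shows "polyhedral (through C P W)"
proof -
  obtain F where F: "finite F" "\<forall>P\<in>F. hpoly P" "W = \<Union>F"
    using assms unfolding polyhedral_iff by blast
  show ?thesis
    unfolding F(3) through_Union[OF F(1,2) assms(2)] using F assms
    by (auto intro!: polyhedral_UN polyhedral_Int polyhedral_pre polyhedral_bound
        intro: polyhedral_hpoly)
qed

lemma enter_mono: "W \<subseteq> W' \<Longrightarrow> enter C P W \<subseteq> enter C P W'"
  unfolding enter_def by blast

lemma through_mono: "W \<subseteq> W' \<Longrightarrow> through C P W \<subseteq> through C P W'"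
  unfolding through_def by (intro Int_mono pre_mono enter_mono) auto

text \<open>By transitivity of \<open>pre\<close>, a point outside \<open>pre C R\<close> has no
  successor in \<open>pre C R\<close>. If it enters the union, it therefore enters
  \<open>Z\<close>.\<close>

lemma through_Un_pre:
  assumes "convex C"
  shows "through C P (Z \<union> pre C R) \<subseteq> through C P Z \<union> pre C R"
proof -
  have "enter C P (Z \<union> pre C R) \<subseteq> enter C P Z \<union> pre C R"
  proof
    fix v assume v: "v \<in> enter C P (Z \<union> pre C R)"
    have "v \<in> enter C P Z" if n: "v \<notin> pre C R"
    proof (cases "v \<in> Z")
      case True
      then show ?thesis
        using v unfolding enter_def by blast
    next
      case False
      then obtain c e where c: "v \<in> P" "c \<in> C" "e > 0"
        and ce: "\<And>t. t \<in> {0<..e} \<Longrightarrow> v + t *\<^sub>R c \<in> Z \<union> pre C R"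
        using v n unfolding enter_def by blast
      have "v + t *\<^sub>R c \<in> Z" if t: "t \<in> {0<..e}" for t
      proof (rule ccontr)
        assume "v + t *\<^sub>R c \<notin> Z"
        then have "v + t *\<^sub>R c \<in> pre C R"
          using ce[OF t] by blast
        then have "v \<in> pre C (pre C R)"
          using t c(2) less_imp_le unfolding pre_def[of C "pre C R"] by fastforce
        then show False
          using n pre_pre[OF assms] by blast
      qed
      then show ?thesis
        using v c unfolding enter_def by blast
    qed
    then show "v \<in> enter C P Z \<union> pre C R"
      by blast
  qed
  then have "pre C (enter C P (Z \<union> pre C R)) \<subseteq> pre C (enter C P Z) \<union> pre C (pre C R)"
    unfolding pre_def[of C "enter C P (Z \<union> pre C R)"] pre_def[of C "enter C P Z"]
      pre_def[of C "pre C R"] by blast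
  then show ?thesis
    unfolding through_def using pre_pre[OF assms, of R] by blast
qed

lemma through_pre_through:
  assumes "convex C"
  shows "P \<inter> pre C (through C P Z) \<subseteq> through C P Z"
proof -
  have "pre C (through C P Z) \<subseteq> pre C (pre C (enter C P Z))"
    unfolding through_def by (intro pre_mono) auto
  also have "\<dots> \<subseteq> pre C (enter C P Z)"
    by (rule pre_pre[OF assms])
  finally show ?thesis
    unfolding through_def by blast
qed

text \<open>Both the set \<open>A\<close> of usable pieces and the target \<open>U\<close> are
  parameters, since the induction removes pieces and changes targets.\<close>

definition reach :: "'a::real_normed_vector set \<Rightarrow> 'a set set \<Rightarrow> 'a set \<Rightarrow> 'a set" where
  "reach C A U = lfp (\<lambda>W. U \<union> (\<Union>P\<in>A. through C P W))"

lemma mono_reach: "mono (\<lambda>W. U \<union> (\<Union>P\<in>A. through C P W))"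
  by (intro monoI Un_mono UN_mono through_mono) auto

lemma reach_unfold: "reach C A U = U \<union> (\<Union>P\<in>A. through C P (reach C A U))"
  unfolding reach_def by (rule lfp_unfold[OF mono_reach])

lemma reach_least:
  "U \<subseteq> X \<Longrightarrow> (\<And>P. P \<in> A \<Longrightarrow> through C P X \<subseteq> X) \<Longrightarrow> reach C A U \<subseteq> X"
  unfolding reach_def by (rule lfp_lowerbound) blast

text \<open>A run may be assumed to cross \<open>P\<close> only once: the stretch between the first and the last visit
  can be replaced by a straight segment in the convex set \<open>P\<close>, since the average of its slopes is
  again in \<open>C\<close>. So the fixpoint over \<open>insert P A\<close> takes only two fixpoints over \<open>A\<close>.\<close>

lemma reach_insert:
  assumes C: "convex C" "C \<noteq> {}"
  shows "reach C (insert P A) U = reach C A (U \<union> through C P (reach C A U))"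
    (is "?L = ?Y")
proof
  let ?Z = "reach C A U"
  let ?R = "through C P ?Z"
  have Z: "through C Q ?Z \<subseteq> ?Z" if "Q \<in> A" for Q
    using reach_unfold[of C A U] that by blast
  have UZ: "U \<subseteq> ?Z"
    using reach_unfold[of C A U] by blast
  have Y: "U \<union> ?R \<subseteq> ?Y"
    using reach_unfold[of C A "U \<union> ?R"] by blast
  \<comment> \<open>Whatever the second fixpoint adds to the first can move straight into
    \<open>?R\<close>. If it also lies in \<open>P\<close>, it is already in \<open>?R\<close>, so
    crossing \<open>P\<close> again gains nothing.\<close>
  have "?Y \<subseteq> ?Z \<union> pre C ?R"
  proof (rule reach_least)
    show "U \<union> ?R \<subseteq> ?Z \<union> pre C ?R"
      using UZ pre_superset[OF C(2)] by blast
    show "through C Q (?Z \<union> pre C ?R) \<subseteq> ?Z \<union> pre C ?R" if "Q \<in> A" for Q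
      using through_Un_pre[OF C(1), of Q ?Z ?R] Z[OF that] by blast
  qed
  then have "through C P ?Y \<subseteq> through C P (?Z \<union> pre C ?R)"
    by (rule through_mono)
  also have "\<dots> \<subseteq> ?R \<union> P \<inter> pre C ?R"
    using through_Un_pre[OF C(1), of P ?Z ?R] by (auto simp: through_def)
  also have "\<dots> \<subseteq> ?R"
    using through_pre_through[OF C(1)] by blast
  finally have PY: "through C P ?Y \<subseteq> ?Y"
    using Y by blast
  show "?L \<subseteq> ?Y"
  proof (rule reach_least)
    show "through C Q ?Y \<subseteq> ?Y" if "Q \<in> insert P A" for Q
      using that PY reach_unfold[of C A "U \<union> ?R"] by blast
  qed (use Y in blast)
  have L: "U \<subseteq> ?L" "through C P ?L \<subseteq> ?L" and LA: "\<And>Q. Q \<in> A \<Longrightarrow> through C Q ?L \<subseteq> ?L"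
    using reach_unfold[of C "insert P A" U] by blast+
  have "?Z \<subseteq> ?L"
    using L LA by (intro reach_least)
  then have "?R \<subseteq> ?L"
    using through_mono L(2) by blast
  then show "?Y \<subseteq> ?L"
    using L LA by (intro reach_least) auto
qed

lemma polyhedral_reach:
  assumes C: "hpoly C" "C \<noteq> {}" and A: "finite A" "\<And>P. P \<in> A \<Longrightarrow> hpoly P"
    and U: "polyhedral U"
  shows "polyhedral (reach C A U)"
  using A U
\<comment> \<open>The recursion uses the fixpoint over \<open>A\<close> for two different
  targets.\<close>
proof (induction A arbitrary: U rule: finite_induct)
  case empty
  then show ?case
    using reach_unfold[of C "{}" U] by simp
next
  case (insert P A)
  then show ?case
    unfolding reach_insert[OF hpoly_convex[OF C(1)] C(2)]
    by (simp add: polyhedral_Un polyhedral_through C)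
qed

subsection \<open>Trajectories\<close>

text \<open>On an interval free of exceptional times the mean value theorem is applied to
  \<open>a \<bullet> f\<close> for each half-space of \<open>C\<close> separately; the intermediate
  time may depend on the half-space. An exceptional time splits the interval, and convexity of
  \<open>C\<close> joins the two averages.\<close>

lemma average_derivative_mem:
  fixes f :: "real \<Rightarrow> 'a::euclidean_space"
  assumes C: "hpoly C" and "finite S" and "s < t" and "continuous_on {s..t} f"
    and "\<And>r. r \<in> {s<..<t} - S \<Longrightarrow> (f has_vector_derivative D r) (at r) \<and> D r \<in> C"
  shows "inverse (t - s) *\<^sub>R (f t - f s) \<in> C"
  using assms(2-)
proof (induction S arbitrary: s t rule: finite_induct)
  case empty
  obtain F where F: "\<And>h. h \<in> F \<Longrightarrow> halfspace h" "C = \<Inter>F"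
    using C unfolding hpoly_def by blast
  have *: "\<exists>r\<in>{s<..<t}. a \<bullet> (inverse (t - s) *\<^sub>R (f t - f s)) = a \<bullet> D r" for a
  proof -
    have "continuous_on {s..t} (\<lambda>x. a \<bullet> f x)"
      using empty by (intro continuous_intros)
    moreover have "((\<lambda>x. a \<bullet> f x) has_derivative (\<lambda>y. a \<bullet> (y *\<^sub>R D r))) (at r)"
      if "s < r" "r < t" for r
      using empty(3)[of r] that
      by (intro has_derivative_inner_right) (auto simp: has_vector_derivative_def)
    ultimately obtain r where r: "s < r" "r < t" "a \<bullet> f t - a \<bullet> f s = a \<bullet> ((t - s) *\<^sub>R D r)"
      using mvt[OF empty(1), of "\<lambda>x. a \<bullet> f x" "\<lambda>r y. a \<bullet> (y *\<^sub>R D r)"] by blast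
    then show ?thesis
      using empty(1) by (intro bexI[of _ r]) (simp_all add: inner_diff_right)
  qed
  have "inverse (t - s) *\<^sub>R (f t - f s) \<in> h" if "h \<in> F" for h
    using F(1)[OF that]
  proof (cases rule: halfspaceE)
    case (1 a b)
    show ?thesis
      using *[of a] empty(3) that unfolding F(2) 1 by fastforce
  next
    case (2 a b)
    show ?thesis
      using *[of a] empty(3) that unfolding F(2) 2 by fastforce
  qed
  then show ?case
    using F(2) by blast
next
  case (insert r S)
  show ?case
  proof (cases "s < r \<and> r < t")
    case False
    then show ?thesis
      using insert.prems by (intro insert.IH) auto
  next
    case True
    let ?x = "inverse (r - s) *\<^sub>R (f r - f s)" and ?y = "inverse (t - r) *\<^sub>R (f t - f r)"
    have "?x \<in> C" "?y \<in> C"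
      using True insert.prems by (auto intro!: insert.IH intro: continuous_on_subset)
    \<comment> \<open>The weights are the relative lengths of the two subintervals.\<close>
    then have "((r - s) / (t - s)) *\<^sub>R ?x + ((t - r) / (t - s)) *\<^sub>R ?y \<in> C"
      using True by (intro convexD[OF hpoly_convex[OF C]])
        (auto simp: add_divide_distrib[symmetric])
    also have "((r - s) / (t - s)) *\<^sub>R ?x + ((t - r) / (t - s)) *\<^sub>R ?y =
        inverse (t - s) *\<^sub>R ((f r - f s) + (f t - f r))"
    proof -
      have "(r - s) / (t - s) * inverse (r - s) = inverse (t - s)"
        "(t - r) / (t - s) * inverse (t - r) = inverse (t - s)"
        using True by (auto simp: field_simps)
      then show ?thesis
        by (simp only: scaleR_scaleR scaleR_add_right)
    qed
    finally show ?thesis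
      by simp
  qed
qed

section \<open>Admissible activities and their concatenation\<close>

lemma at_within_atLeast_neq_bot: "t \<ge> a \<Longrightarrow> at t within {a..} \<noteq> (bot :: real filter)"
  using at_le[of "{t<..}" "{a..}" t] trivial_limit_at_right_real[of t]
  by (metis atLeast_iff bot_unique greaterThan_iff less_imp_le order.trans subsetI)

text \<open>Uniqueness of derivatives on the half-line, including the one-sided one at 0, allows
  \<open>vector_derivative\<close> to be replaced by a relation that transfers well between
  functions.\<close>

lemma Adm_iff:
  "f \<in> Adm H l u \<longleftrightarrow> continuous_on {0..} f \<and> f 0 = u \<and>
     finite {t \<in> {0..}. \<nexists>D. (f has_vector_derivative D) (at t within {0..})} \<and>
     (\<forall>t\<ge>0. \<forall>D. (f has_vector_derivative D) (at t within {0..}) \<longrightarrow> D \<in> Flow H l)"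
proof -
  have diff: "f differentiable (at t within {0..}) \<longleftrightarrow>
      (\<exists>D. (f has_vector_derivative D) (at t within {0..}))" for t
    by (meson differentiableI_vector vector_derivative_works)
  have eq: "vector_derivative f (at t within {0..}) = D"
    if "t \<ge> 0" "(f has_vector_derivative D) (at t within {0..})" for t D
    using that vector_derivative_within at_within_atLeast_neq_bot by blast
  have "(\<forall>t\<ge>0. (\<exists>D. (f has_vector_derivative D) (at t within {0..})) \<longrightarrow>
      vector_derivative f (at t within {0..}) \<in> Flow H l) \<longleftrightarrow>
    (\<forall>t\<ge>0. \<forall>D. (f has_vector_derivative D) (at t within {0..}) \<longrightarrow> D \<in> Flow H l)"
    using eq by metis
  then show ?thesis
    unfolding Adm_def activity_def diff mem_Collect_eq by blast
qed

lemma Adm_linear: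
  assumes "c \<in> Flow H l"
  shows "(\<lambda>t. u + t *\<^sub>R c) \<in> Adm H l u"
proof -
  have *: "((\<lambda>t. u + t *\<^sub>R c) has_vector_derivative c) (at t within {0..})" for t
    by (auto intro!: derivative_eq_intros)
  then have ex_derivative: "(\<exists>D. ((\<lambda>t. u + t *\<^sub>R c) has_vector_derivative D) (at t within {0..}))
      \<longleftrightarrow> True" for t
    by blast
  have "D = c" if "t \<ge> 0" "((\<lambda>t. u + t *\<^sub>R c) has_vector_derivative D) (at t within {0..})" for t D
    using vector_derivative_unique_within[OF at_within_atLeast_neq_bot[OF that(1)] that(2) *] .
  then show ?thesis
    unfolding Adm_iff using assms by (auto intro!: continuous_intros simp del: not_ex simp: ex_derivative)
qed

lemma has_vector_derivative_shift:
  "((\<lambda>x. f (x - d)) has_vector_derivative D) (at t) \<longleftrightarrow> (f has_vector_derivative D) (at (t - d))"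
proof -
  have *: "((\<lambda>x. g (x + e)) has_vector_derivative D) (at t)"
    if "(g has_vector_derivative D) (at (t + e))" for g e t
  proof -
    have "((\<lambda>x. x + e) has_vector_derivative 1) (at t)"
      by (auto intro!: derivative_eq_intros)
    from vector_diff_chain_at[OF this that] show ?thesis
      by (simp add: o_def)
  qed
  show ?thesis
    using *[of f t "- d"] *[of "\<lambda>x. f (x - d)" "t - d" d] by auto
qed

text \<open>Only the switching time \<open>d\<close> can be a new point of non-differentiability;
  all other exceptional times are shifted ones of \<open>f\<close>.\<close>

lemma Adm_prepend:
  assumes f: "f \<in> Adm H l (u + d *\<^sub>R c)" and c: "c \<in> Flow H l" and d: "d > 0"
  shows "(\<lambda>t. if t \<le> d then u + t *\<^sub>R c else f (t - d)) \<in> Adm H l u"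
    (is "?g \<in> _")
proof -
  note f = f[unfolded Adm_iff]
  have lin: "((\<lambda>t. u + t *\<^sub>R c) has_vector_derivative c) (at t within X)" for t X
    by (auto intro!: derivative_eq_intros)
  have before: "(?g has_vector_derivative c) (at t within {0..})" if "0 \<le> t" "t < d" for t
    by (rule has_vector_derivative_transform_within[OF lin, of "d - t"])
      (use that in \<open>auto simp: dist_real_def\<close>)
  have within: "at t within {0..} = at t" if "t > 0" for t :: real
    using that by (intro at_within_interior) (simp add: interior_real_atLeast)
  have after: "(?g has_vector_derivative D) (at t within {0..}) \<longleftrightarrow>
      (f has_vector_derivative D) (at (t - d) within {0..})" if "t > d" for t D
  proof -
    have "(?g has_vector_derivative D) (at t) \<longleftrightarrow>
        ((\<lambda>t. f (t - d)) has_vector_derivative D) (at t)"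
      using that
      by (auto elim!: has_vector_derivative_transform_within_open[of _ _ _ "{d<..}"])
    then show ?thesis
      using that d by (simp add: within has_vector_derivative_shift)
  qed
  \<comment> \<open>If the corner happens to be smooth, its derivative agrees with the one from the
    left, where the activity is linear.\<close>
  have switch: "D = c" if "(?g has_vector_derivative D) (at d within {0..})" for D
  proof -
    have "(?g has_vector_derivative D) (at d within {0..d})"
      using that by (rule has_vector_derivative_within_subset) auto
    then have "((\<lambda>t. u + t *\<^sub>R c) has_vector_derivative D) (at d within {0..d})"
      by (rule has_vector_derivative_transform_within[of _ _ _ _ 1]) (use d in auto)
    then show ?thesis
      using d lin by (intro vector_derivative_unique_within) (auto simp: at_within_Icc_at_left)
  qed
  have "continuous_on {0..} ?g"
  proof (rule continuous_on_cases_le)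
    show "continuous_on {t \<in> {0..}. d \<le> t} (\<lambda>t. f (t - d))"
      by (rule continuous_on_compose2[of "{0..}" f]) (use f in \<open>auto intro!: continuous_intros\<close>)
    show "u + t *\<^sub>R c = f (t - d)" if "t \<in> {0..}" "t = d" for t
      using f that by simp
  qed (auto intro!: continuous_intros)
  moreover have "finite {t \<in> {0..}. \<nexists>D. (?g has_vector_derivative D) (at t within {0..})}"
  proof (rule finite_subset)
    let ?N = "{t \<in> {0..}. \<nexists>D. (f has_vector_derivative D) (at t within {0..})}"
    show "finite (insert d ((\<lambda>t. t + d) ` ?N))"
      using f by simp
    show "{t \<in> {0..}. \<nexists>D. (?g has_vector_derivative D) (at t within {0..})}
        \<subseteq> insert d ((\<lambda>t. t + d) ` ?N)"
    proof
      fix t assume t: "t \<in> {t \<in> {0..}. \<nexists>D. (?g has_vector_derivative D) (at t within {0..})}"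
      then consider "t = d" | "t > d"
        using before by force
      then show "t \<in> insert d ((\<lambda>t. t + d) ` ?N)"
      proof cases
        case 2
        then have "t - d \<in> ?N"
          using t after by auto
        then have "t - d + d \<in> (\<lambda>t. t + d) ` ?N"
          by (rule imageI)
        then show ?thesis
          by simp
      qed simp
    qed
  qed
  moreover have "D \<in> Flow H l" if D: "(?g has_vector_derivative D) (at t within {0..})" "t \<ge> 0" for t D
  proof -
    consider "t < d" | "t = d" | "t > d"
      by linarith
    then show ?thesis
    proof cases
      case 1
      then show ?thesis
        using vector_derivative_unique_within[OF at_within_atLeast_neq_bot D(1) before] D(2) c by simp
    next
      case 2
      then show ?thesis
        using switch[of D] D(1) c by blast
    next
      case 3
      then show ?thesis
        using after[OF 3, of D] D(1) f 3 by (meson diff_ge_0_iff_ge less_imp_le)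
    qed
  qed
  ultimately show ?thesis
    unfolding Adm_iff using d by auto
qed

section \<open>Closure of \<open>RWA_may\<close> under the operator\<close>

lemma RWA_may_prepend:
  assumes w: "u + d *\<^sub>R c \<in> RWA_may H l U V" and c: "c \<in> Flow H l" and d: "d \<ge> 0"
    and seg: "\<And>t. 0 \<le> t \<Longrightarrow> t < d \<Longrightarrow> u + t *\<^sub>R c \<in> - V \<union> U"
  shows "u \<in> RWA_may H l U V"
proof (cases "d = 0")
  case True
  then show ?thesis using w by simp
next
  case False
  then have "d > 0"
    using d by simp
  obtain f e where f: "f \<in> Adm H l (u + d *\<^sub>R c)" and e: "e \<ge> 0" "f e \<in> U"
    and fe: "\<And>t. 0 \<le> t \<Longrightarrow> t < e \<Longrightarrow> f t \<in> - V \<union> U"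
    using w unfolding RWA_may_def by blast
  let ?g = "\<lambda>t. if t \<le> d then u + t *\<^sub>R c else f (t - d)"
  have f0: "f 0 = u + d *\<^sub>R c"
    using f by (simp add: Adm_def)
  \<comment> \<open>For \<open>e = 0\<close> the linear branch applies, and it agrees with
    \<open>f 0\<close>.\<close>
  have "?g (e + d) \<in> U"
    using e f0 by (cases "e = 0") auto
  moreover have "?g t \<in> - V \<union> U" if "0 \<le> t" "t < e + d" for t
  proof (cases "t < d")
    case True
    then show ?thesis
      using seg that by auto
  next
    case False
    then have "?g t = f (t - d)"
      using f0 by auto
    then show ?thesis
      using fe[of "t - d"] that False by auto
  qed
  ultimately show ?thesis
    unfolding RWA_may_def using Adm_prepend[OF f c \<open>d > 0\<close>] e d
    by (intro CollectI bexI[of _ ?g] exI[of _ "e + d"]) auto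
qed

lemma RWA_may_superset: "Flow H l \<noteq> {} \<Longrightarrow> U \<subseteq> RWA_may H l U V"
  unfolding RWA_may_def using Adm_linear by (force intro: exI[of _ 0])

lemma RWA_may_subset: "RWA_may H l U V \<subseteq> - V \<union> U"
proof
  fix u assume "u \<in> RWA_may H l U V"
  then obtain f d where f: "f \<in> Adm H l u" and d: "d \<ge> 0" "f d \<in> U"
    and fd: "\<forall>t. 0 \<le> t \<and> t < d \<longrightarrow> f t \<in> - V \<union> U"
    unfolding RWA_may_def mem_Collect_eq by (elim bexE exE conjE)
  have "f 0 = u"
    using f by (simp add: Adm_def)
  then show "u \<in> - V \<union> U"
    using d fd by (cases "d = 0") auto
qed

text \<open>Two segments are prepended: a short one from the entry point, if that point is not yet
  in the set, and the one that leads to the entry point, which stays in \<open>P\<close> before its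
  end.\<close>

lemma through_RWA_may_subset:
  assumes P: "hpoly P" "P \<subseteq> - V"
  shows "through (Flow H l) P (RWA_may H l U V) \<subseteq> RWA_may H l U V"
proof
  let ?R = "RWA_may H l U V"
  fix u assume "u \<in> through (Flow H l) P ?R"
  then obtain d c where u: "u \<in> P" and d: "d \<ge> 0" "c \<in> Flow H l"
    and v: "u + d *\<^sub>R c \<in> enter (Flow H l) P ?R"
    unfolding through_def pre_def by blast
  have "u + d *\<^sub>R c \<in> ?R"
  proof (cases "u + d *\<^sub>R c \<in> ?R")
    case False
    then obtain c' e where c': "u + d *\<^sub>R c \<in> P" "c' \<in> Flow H l" "e > 0"
      and e: "\<And>t. t \<in> {0<..e} \<Longrightarrow> u + d *\<^sub>R c + t *\<^sub>R c' \<in> ?R"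
      using v unfolding enter_def by blast
    show ?thesis
    proof (rule RWA_may_prepend)
      show "u + d *\<^sub>R c + e *\<^sub>R c' \<in> ?R"
        using e c' by simp
      show "u + d *\<^sub>R c + t *\<^sub>R c' \<in> - V \<union> U" if "0 \<le> t" "t < e" for t
      proof (cases "t = 0")
        case True
        then show ?thesis
          using c'(1) P(2) by auto
      next
        case False
        then have "u + d *\<^sub>R c + t *\<^sub>R c' \<in> ?R"
          using e that by simp
        then show ?thesis
          by (rule subsetD[OF RWA_may_subset])
      qed
    qed (use c' in auto)
  qed
  then show "u \<in> ?R"
  proof (rule RWA_may_prepend)
    show "u + t *\<^sub>R c \<in> - V \<union> U" if "0 \<le> t" "t < d" for t
    proof -
      have "u + d *\<^sub>R c \<in> closure P"
        using v unfolding enter_def by blast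
      \<comment> \<open>The segment is read backwards from its end, which may lie only in the
        closure of \<open>P\<close>; \<open>t < d\<close> keeps the weight of \<open>u\<close>
        positive.\<close>
      then have "(u + d *\<^sub>R c) + (1 - t / d) *\<^sub>R (u - (u + d *\<^sub>R c)) \<in> P"
        using that u by (intro hpoly_segment[OF P(1)]) (auto simp: field_simps)
      moreover have "(u + d *\<^sub>R c) + (1 - t / d) *\<^sub>R (u - (u + d *\<^sub>R c)) = u + t *\<^sub>R c"
        using that by (simp add: algebra_simps)
      ultimately have "u + t *\<^sub>R c \<in> P"
        by (simp only:)
      then show ?thesis
        using P(2) by auto
    qed
  qed (use d in auto)
qed

section \<open>Comparison of activities with closed polyhedra\<close>

lemma Adm_average:
  assumes H: "hpoly (Flow H l)" and f: "f \<in> Adm H l u" and st: "0 \<le> s" "s < t"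
  obtains c where "c \<in> Flow H l" "f t = f s + (t - s) *\<^sub>R c"
proof -
  note f = f[unfolded Adm_iff]
  let ?N = "{t \<in> {0..}. \<nexists>D. (f has_vector_derivative D) (at t within {0..})}"
  have "\<forall>r. \<exists>D. r \<in> {s<..<t} - ?N \<longrightarrow> (f has_vector_derivative D) (at r) \<and> D \<in> Flow H l"
  proof
    fix r
    show "\<exists>D. r \<in> {s<..<t} - ?N \<longrightarrow> (f has_vector_derivative D) (at r) \<and> D \<in> Flow H l"
    proof (cases "r \<in> {s<..<t} - ?N")
      case True
      then have "r > 0"
        using st by simp
      then have "at r within {0..} = at r"
        by (intro at_within_interior) (simp add: interior_real_atLeast)
      moreover obtain D where "(f has_vector_derivative D) (at r within {0..})"
        using True \<open>r > 0\<close> by auto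
      ultimately show ?thesis
        using f \<open>r > 0\<close> by (metis less_imp_le)
    qed blast
  qed
  from choice[OF this] obtain D where
    "\<And>r. r \<in> {s<..<t} - ?N \<Longrightarrow> (f has_vector_derivative D r) (at r) \<and> D r \<in> Flow H l"
    by blast
  then have "inverse (t - s) *\<^sub>R (f t - f s) \<in> Flow H l"
    using f st by (intro average_derivative_mem[OF H, of ?N]) (auto intro: continuous_on_subset)
  moreover have "f t = f s + (t - s) *\<^sub>R (inverse (t - s) *\<^sub>R (f t - f s))"
    using st by simp
  ultimately show ?thesis
    using that by blast
qed

lemma RWA_may_subset_closed:
  assumes H: "hpoly (Flow H l)" and A: "finite A" "\<Union>A = - V"
    and Y: "polyhedral Y" "U \<subseteq> Y" "\<And>P. P \<in> A \<Longrightarrow> through (Flow H l) P Y \<subseteq> Y"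
  shows "RWA_may H l U V \<subseteq> Y"
proof
  fix u assume "u \<in> RWA_may H l U V"
  then obtain f d where f: "f \<in> Adm H l u" and d: "d \<ge> 0" "f d \<in> U"
    and fd: "\<And>t. 0 \<le> t \<Longrightarrow> t < d \<Longrightarrow> f t \<in> - V \<union> U"
    unfolding RWA_may_def by blast
  have f0: "f 0 = u" and cont: "continuous_on {0..} f"
    using f by (auto simp: Adm_iff)
  \<comment> \<open>Freezing the activity at negative times makes it continuous on the whole line,
    so one-sided limits at \<open>s\<close> are available even for \<open>s = 0\<close>.\<close>
  have "isCont (\<lambda>t. f (max 0 t)) s" for s
  proof -
    have "continuous_on UNIV (\<lambda>t. f (max 0 t))"
      by (rule continuous_on_compose2[OF cont]) (auto intro!: continuous_intros)
    then show ?thesis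
      by (simp add: continuous_on_eq_continuous_at)
  qed
  then have lim: "((\<lambda>t. f (max 0 t)) \<longlongrightarrow> f s) (at s within X)" if "s \<ge> 0" for s X
    using that by (metis continuous_at_imp_continuous_at_within continuous_within max.absorb2)
  show "u \<in> Y"
  proof (rule ccontr)
    assume "u \<notin> Y"
    define T where "T = {t \<in> {0..d}. f t \<in> Y}"
    define s where "s = Inf T"
    have "d \<in> T"
      using d Y(2) by (auto simp: T_def)
    have bdd: "bdd_below T"
      unfolding T_def by (intro bdd_belowI[of _ 0]) auto
    have "s \<le> d"
      unfolding s_def using \<open>d \<in> T\<close> bdd by (rule cInf_lower)
    have "0 \<le> s"
      unfolding s_def using \<open>d \<in> T\<close> by (intro cInf_greatest) (auto simp: T_def)
    have before: "f t \<notin> Y" "f t \<in> \<Union>A" if "0 \<le> t" "t < s" for t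
    proof -
      have "t \<notin> T"
        using that cInf_lower[OF _ bdd, of t] by (auto simp: s_def)
      then show "f t \<notin> Y"
        using that \<open>s \<le> d\<close> by (auto simp: T_def)
      then show "f t \<in> \<Union>A"
        using fd[of t] that \<open>s \<le> d\<close> Y(2) A(2) by auto
    qed
    show False
    proof (cases "f s \<in> Y")
      case True
      then have "s > 0"
        using \<open>u \<notin> Y\<close> f0 \<open>0 \<le> s\<close> by (cases "s = 0") auto
      then have ev: "\<forall>\<^sub>F t in at_left s. 0 < t \<and> t < s"
        by (intro eventually_at_leftI[of 0]) auto
      have "\<forall>\<^sub>F t in at_left s. \<exists>P\<in>A. f (max 0 t) \<in> P"
        using ev by (rule eventually_mono) (use before(2) in auto)
      then have "\<exists>\<^sub>F t in at_left s. \<exists>P\<in>A. f (max 0 t) \<in> P"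
        by (intro eventually_frequently) auto
      from frequently_bex_finite[OF A(1) this]
      obtain P where P: "P \<in> A" "\<exists>\<^sub>F t in at_left s. f (max 0 t) \<in> P"
        by blast
      have "f s \<in> closure P"
        using frequently_closure[OF lim P(2)] \<open>0 \<le> s\<close> by blast
      then have s: "f s \<in> enter (Flow H l) P Y"
        using True unfolding enter_def by blast
      \<comment> \<open>From this earlier point of \<open>P\<close> a straight move leads to
        \<open>f s\<close>, so it lies in \<open>through\<close> although it is outside
        \<open>Y\<close>.\<close>
      obtain t where t: "0 < t" "t < s" "f t \<in> P"
        using frequently_ex[OF frequently_eventually_frequently[OF P(2) ev]] by auto
      obtain c where "c \<in> Flow H l" "f s = f t + (s - t) *\<^sub>R c"
        using Adm_average[OF H f, of t s] t by auto
      then have "f t \<in> through (Flow H l) P Y"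
        using s t unfolding through_def pre_def
        by (auto intro!: exI[of _ "s - t"] bexI[of _ c])
      then show False
        using Y(3)[OF P(1)] before(1)[of t] t by auto
    next
      case False
      then have "s < d"
        using d Y(2) \<open>s \<le> d\<close> by (cases "s = d") auto
      then obtain P where P: "P \<in> A" "f s \<in> P"
        using fd[of s] \<open>0 \<le> s\<close> False Y(2) A(2) by auto
      obtain F where F: "finite F" "\<forall>P\<in>F. hpoly P" "Y = \<Union>F"
        using Y(1) unfolding polyhedral_iff by blast
      \<comment> \<open>The infimum is not attained, so times in \<open>T\<close> accumulate at it
        from the right.\<close>
      have "\<exists>\<^sub>F t in at_right s. \<exists>P'\<in>F. f (max 0 t) \<in> P'"
      proof (rule ccontr)
        assume "\<not> ?thesis"
        then obtain b where b: "b > s" "\<And>t. s < t \<Longrightarrow> t < b \<Longrightarrow> f (max 0 t) \<notin> Y"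
          unfolding not_frequently eventually_at_right_field F(3) by auto
        obtain t where t: "t \<in> T" "t < b"
          using b(1) \<open>d \<in> T\<close> unfolding s_def by (metis cInf_lessD empty_iff)
        then have "s < t"
          using False cInf_lower[OF t(1) bdd] by (cases "s = t") (auto simp: s_def T_def)
        then show False
          using b(2)[of t] t by (auto simp: T_def)
      qed
      from frequently_bex_finite[OF F(1) this]
      obtain P' where P': "P' \<in> F" "\<exists>\<^sub>F t in at_right s. f (max 0 t) \<in> P'"
        by blast
      have cl: "f s \<in> closure P'"
        using frequently_closure[OF lim P'(2)] \<open>0 \<le> s\<close> by blast
      obtain t where t: "s < t" "f t \<in> P'"
        using frequently_ex[OF frequently_eventually_frequently[OF P'(2) eventually_at_right_less]]
          \<open>0 \<le> s\<close> by auto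
      obtain c where c: "c \<in> Flow H l" "f t = f s + (t - s) *\<^sub>R c"
        using Adm_average[OF H f \<open>0 \<le> s\<close> t(1)] by blast
      \<comment> \<open>The activity itself may leave \<open>P'\<close> between \<open>s\<close> and
        \<open>t\<close>; the straight segment that replaces it does not.\<close>
      have "f s + r *\<^sub>R c \<in> Y" if "r \<in> {0<..t - s}" for r
      proof -
        have "f s + (r / (t - s)) *\<^sub>R (f t - f s) \<in> P'"
          using that t cl F(2) P'(1) by (intro hpoly_segment) auto
        then show ?thesis
          using c(2) t(1) P'(1) F(3) by auto
      qed
      then have "f s \<in> enter (Flow H l) P Y"
        using P(2) c(1) t(1) closure_subset unfolding enter_def
        by (auto intro!: bexI[of _ c] exI[of _ "t - s"])
      then have "f s \<in> through (Flow H l) P Y"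
        using P(2) c(1) pre_superset[of "Flow H l"] unfolding through_def by blast
      then show False
        using Y(3)[OF P(1)] False by blast
    qed
  qed
qed

text \<open>With an empty flow no activity would exist and \<open>RWA_may\<close> would be empty,
  whereas every fixpoint of \<open>tau\<close> contains \<open>U\<close>; hence the flow is assumed
  nonempty.\<close>

theorem theorem3:
  fixes H :: "('l, 'n::finite, 'z) lha_scheme" and l :: 'l
    and rep :: "(real ^ 'n) set \<Rightarrow> (real ^ 'n) set set"
    and U V :: "(real ^ 'n) set"
  assumes "linear_hybrid_automaton H" and "l \<in> Loc H" and "Flow H l \<noteq> {}"
    and "representation rep"
    and "polyhedral U" and "polyhedral V"
  shows "least_fixpoint_in {W. polyhedral W} (\<lambda>W. tau H l rep U V W) (RWA_may H l U V)"
proof -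
  let ?C = "Flow H l" and ?R = "RWA_may H l U V"
  have C: "hpoly ?C"
    using assms(1,2) by (simp add: linear_hybrid_automaton_def convex_polyhedral_iff)
  have rep: "finite (rep G)" "\<forall>P\<in>rep G. hpoly P" "\<Union>(rep G) = G" if "polyhedral G" for G
    using assms(4) that by (auto simp: representation_def convex_polyhedral_iff)
  let ?A = "rep (- V)"
  note A = rep[OF polyhedral_Compl[OF assms(6)]]
  have tau: "tau H l rep U V W = U \<union> (\<Union>P\<in>?A. through ?C P W)" if "polyhedral W" for W
    using through_Union[OF rep(1,2)[OF that] assms(3)] rep(3)[OF that]
    by (simp add: tau_def pre_flow_eq)
  let ?X = "reach ?C ?A U"
  have X: "polyhedral ?X"
    using polyhedral_reach[OF C assms(3) A(1) _ assms(5)] A(2) by blast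
  have "?R = ?X"
  proof
    show "?R \<subseteq> ?X"
      using reach_unfold[of ?C ?A U] by (intro RWA_may_subset_closed[OF C A(1,3) X]) blast+
    show "?X \<subseteq> ?R"
      using A(2,3) by (intro reach_least RWA_may_superset[OF assms(3)] through_RWA_may_subset) auto
  qed
  moreover have "tau H l rep U V ?X = ?X"
    using tau[OF X] reach_unfold[of ?C ?A U] by simp
  moreover have "?X \<subseteq> Y" if "polyhedral Y" "tau H l rep U V Y = Y" for Y
    using tau[OF that(1)] that(2) by (intro reach_least) auto
  ultimately show ?thesis
    using X by (simp add: least_fixpoint_in_def)
qed

end
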